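(* Let $n \in \mathbb{N}$ (a positive integer) be divisible by $12$. Then there is an oriented graph $G$ on $n$ vertices with $\delta^0(G) = 5n/12 - 1$ which does not contain the square of a Hamilton cycle.
   Context: Digraphs have no loops and have at most one edge in each direction between any pair of vertices. An oriented graph is a digraph containing no 2-cycle, i.e. there is at most one directed edge between any pair of distinct vertices. For a digraph $G$, the minimum semidegree $\delta^0(G)$ is the minimum of its minimum outdegree $\delta^+(G)$ and its minimum indegree $\delta^-(G)$. A Hamilton cycle of a digraph $G$ is a directed cycle passing through every vertex of $G$ exactly once. The square of a Hamilton cycle $C$ is the digraph obtained from $C$ by adding a directed edge from $x$ to $y$ whenever there is a directed path of length at most $2$ from $x$ to $y$ on $C$. So $G$ contains the square of a Hamilton cycle if its vertices can be cyclically ordered as $v_0, v_1, \dots, v_{n-1}$ such that $v_iv_{i+1}$ and $v_iv_{i+2}$ are edges of $G$ (directed from the first vertex to the second) for every $i$, with indices modulo $n$. *)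

theory Defs
  imports Complex_Main "Graph_Theory.Graph_Theory"
begin

text \<open>The locale \<^locale>\<open>digraph\<close> already requires finiteness and excludes loops and parallel arcs.\<close>

locale oriented_graph = digraph +
  assumes no_2cycle: "u \<rightarrow>\<^bsub>G\<^esub> v \<Longrightarrow> \<not> v \<rightarrow>\<^bsub>G\<^esub> u"

text \<open>The minimum degrees are meaningful for finite, nonempty vertex sets only.\<close>

definition min_out_degree :: "('a, 'b) pre_digraph \<Rightarrow> nat" where
  "min_out_degree G = Min (out_degree G ` verts G)"

definition min_in_degree :: "('a, 'b) pre_digraph \<Rightarrow> nat" where
  "min_in_degree G = Min (in_degree G ` verts G)"

definition min_semidegree :: "('a, 'b) pre_digraph \<Rightarrow> nat" where
  "min_semidegree G = min (min_out_degree G) (min_in_degree G)"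

text \<open>A Hamilton cycle is given by the list of its vertices in cyclic order.\<close>

definition hamilton_cycle :: "('a, 'b) pre_digraph \<Rightarrow> 'a list \<Rightarrow> bool" where
  "hamilton_cycle G vs \<longleftrightarrow>
     vs \<noteq> [] \<and> distinct vs \<and> set vs = verts G \<and>
     (\<forall>i < length vs. vs ! i \<rightarrow>\<^bsub>G\<^esub> vs ! ((i + 1) mod length vs))"

definition contains_square_of_hamilton_cycle :: "('a, 'b) pre_digraph \<Rightarrow> bool" where
  "contains_square_of_hamilton_cycle G \<longleftrightarrow>
     (\<exists>vs. hamilton_cycle G vs \<and>
       (\<forall>i < length vs. vs ! i \<rightarrow>\<^bsub>G\<^esub> vs ! ((i + 2) mod length vs)))"

end

theory Submission
  imports Defs "HOL-Number_Theory.Cong"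
begin

text \<open>
  Put $n = 12k$. Take the blow-up of a directed triangle with classes of sizes $4k+1$, $4k$,
  $4k-1$, and place inside every class an almost balanced blow-up of a directed 4-cycle. The
  semidegrees are about $4k + k$. In the square of a Hamilton cycle any three
  consecutive vertices $x, y, z$ span a transitive triangle. The three cannot lie in one class,
  as a blow-up of a 4-cycle is triangle-free, and it follows that $z$ always lies in the
  class after that of $x$. So the shift by two along the cycle maps each class injectively
  into the next one, although the first class is larger than the second.
\<close>

text \<open>
  The label \<open>4 * c + s\<close>, with \<open>c < 3\<close> and \<open>s < 4\<close>, stands for position \<open>s\<close> on the 4-cycle in
  class \<open>c\<close>. Relabelling the vertex 8 unbalances the otherwise equal classes.
\<close>

definition label :: "nat \<Rightarrow> nat" where
  "label v = (if v = 8 then 0 else v mod 12)"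

definition label_arc :: "nat \<Rightarrow> nat \<Rightarrow> bool" where
  "label_arc i j \<longleftrightarrow>
     j div 4 = (i div 4 + 1) mod 3 \<or> j div 4 = i div 4 \<and> j mod 4 = (i + 1) mod 4"

definition extremal_graph :: "nat \<Rightarrow> (nat, nat \<times> nat) pre_digraph" where
  "extremal_graph n =
     \<lparr>verts = {..<n}, arcs = {(u, v). u < n \<and> v < n \<and> label_arc (label u) (label v)},
      tail = fst, head = snd\<rparr>"

lemma label_less: "label v < 12"
  by (simp add: label_def)

text \<open>Neither a directed triangle nor a directed 4-cycle contains a 2-cycle, and an arc
  between classes cannot be undone by one inside a class. The case \<open>j = i\<close> also rules
  out loops.\<close>

lemma label_arc_asym:
  assumes "label_arc i j" and "i < 12"
  shows "\<not> label_arc j i"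
proof -
  have "i div 4 < 3" using assms(2) by (simp add: less_mult_imp_div_less)
  then have "(i div 4 + 1) mod 3 \<noteq> i div 4" "((i div 4 + 1) mod 3 + 1) mod 3 \<noteq> i div 4"
    by (auto simp: mod_Suc)
  moreover have "(i + 1) mod 4 = j mod 4 \<Longrightarrow> (j + 1) mod 4 \<noteq> i mod 4"
    by (auto simp: mod_Suc split: if_splits)
  ultimately show ?thesis using assms(1) unfolding label_arc_def by metis
qed

lemma label_arc_transitive_triangle:
  assumes "label_arc i j" "label_arc j l" "label_arc i l" and "i < 12"
  shows "l div 4 = (i div 4 + 1) mod 3"
proof (rule ccontr)
  assume neq: "l div 4 \<noteq> (i div 4 + 1) mod 3"
  then have l: "l div 4 = i div 4" "l mod 4 = (i + 1) mod 4"
    using assms(3) by (auto simp: label_arc_def)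
  have "i div 4 < 3" using assms(4) by (simp add: less_mult_imp_div_less)
  then have *: "(i div 4 + 1) mod 3 \<noteq> i div 4" "((i div 4 + 1) mod 3 + 1) mod 3 \<noteq> i div 4"
    by (auto simp: mod_Suc)
  \<comment> \<open>If \<open>j\<close> lay in the next class, arcs from it could not return to the
    class of \<open>i\<close>. So all three labels share a class, and \<open>l\<close> is both one
    and two steps after \<open>i\<close> on the 4-cycle.\<close>
  then have "j mod 4 = (i + 1) mod 4" "l mod 4 = (j + 1) mod 4"
    using assms(1,2) l(1) unfolding label_arc_def by metis+
  with l(2) show False by (auto simp: mod_Suc split: if_splits)
qed

lemma extremal_graph_arc_iff:
  "u \<rightarrow>\<^bsub>extremal_graph n\<^esub> v \<longleftrightarrow> u < n \<and> v < n \<and> label_arc (label u) (label v)"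
  by (force simp: arcs_ends_def arc_to_ends_def extremal_graph_def)

lemma oriented_extremal_graph: "oriented_graph (extremal_graph n)"
proof
  show "finite (arcs (extremal_graph n))"
    by (rule finite_subset[of _ "{..<n} \<times> {..<n}"]) (auto simp: extremal_graph_def)
  show "tail (extremal_graph n) e \<noteq> head (extremal_graph n) e"
    if "e \<in> arcs (extremal_graph n)" for e
    using that label_arc_asym label_less by (fastforce simp: extremal_graph_def)
  show "\<not> v \<rightarrow>\<^bsub>extremal_graph n\<^esub> u" if "u \<rightarrow>\<^bsub>extremal_graph n\<^esub> v" for u v
    using that label_arc_asym label_less unfolding extremal_graph_arc_iff by blast
qed (auto simp: extremal_graph_def arc_to_ends_def)

lemma card_mod_eq:
  assumes "i < m"
  shows "card {v. v < m * k \<and> v mod m = i} = (k::nat)"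
proof -
  have "{v. v < m * k \<and> v mod m = i} = (\<lambda>q. m * q + i) ` {..<k}"
  proof (intro equalityI subsetI)
    fix v assume v: "v \<in> {v. v < m * k \<and> v mod m = i}"
    then have "v = m * (v div m) + i" by auto
    moreover have "v div m < k" using v by (simp add: less_mult_imp_div_less mult.commute)
    ultimately show "v \<in> (\<lambda>q. m * q + i) ` {..<k}" by blast
  next
    fix v assume "v \<in> (\<lambda>q. m * q + i) ` {..<k}"
    then obtain q where q: "q < k" "v = m * q + i" by blast
    have "m * q + i < m * Suc q" using assms by simp
    also have "\<dots> \<le> m * k" using q(1) by (intro mult_le_mono2) simp
    finally show "v \<in> {v. v < m * k \<and> v mod m = i}" using q(2) assms by simp
  qed
  moreover have "inj_on (\<lambda>q. m * q + i) {..<k}"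
    using assms by (auto simp: inj_on_def)
  ultimately show ?thesis by (simp add: card_image)
qed

definition label_size :: "nat \<Rightarrow> nat \<Rightarrow> nat" where
  "label_size k i = (if i = 0 then k + 1 else if i = 8 then k - 1 else k)"

lemma card_label_eq:
  assumes "k > 0" and "i < 12"
  shows "card {v. v < 12 * k \<and> label v = i} = label_size k i"
proof -
  define M where "M = {v. v < 12 * k \<and> v mod 12 = i}"
  have M: "finite M" "card M = k" using assms(2) by (auto simp: M_def intro: card_mod_eq)
  \<comment> \<open>Vertex 8 has residue 8, so for \<open>i\<close> other than 0 and 8 removing it
    leaves \<open>M\<close> unchanged.\<close>
  have "{v. v < 12 * k \<and> label v = i} = (if i = 0 then insert 8 M else M - {8})"
    using assms by (auto simp: M_def label_def split: if_splits)
  moreover have "8 \<in> M \<longleftrightarrow> i = 8" using assms by (auto simp: M_def)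
  ultimately show ?thesis using M by (simp add: label_size_def)
qed

text \<open>Reduces degrees and class sizes to sums of twelve terms that the simplifier can
  evaluate.\<close>

lemma card_label_Collect:
  assumes "k > 0"
  shows "card {v. v < 12 * k \<and> P (label v)} = (\<Sum>i<12. if P i then label_size k i else 0)"
proof -
  have "{v. v < 12 * k \<and> P (label v)} =
      (\<Union>i\<in>{i. i < 12 \<and> P i}. {v. v < 12 * k \<and> label v = i})"
    using label_less by auto
  also have "card \<dots> = (\<Sum>i | i < 12 \<and> P i. card {v. v < 12 * k \<and> label v = i})"
    by (rule card_UN_disjoint) auto
  also have "\<dots> = (\<Sum>i | i < 12 \<and> P i. label_size k i)"
    using assms by (intro sum.cong) (auto simp: card_label_eq)
  also have "\<dots> = (\<Sum>i<12. if P i then label_size k i else 0)"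
    by (simp add: sum.inter_filter[symmetric])
  finally show ?thesis .
qed

lemma out_degree_extremal_graph:
  assumes "k > 0" and "v < 12 * k"
  shows "out_degree (extremal_graph (12 * k)) v =
    (\<Sum>i<12. if label_arc (label v) i then label_size k i else 0)"
proof -
  have "out_arcs (extremal_graph (12 * k)) v =
      Pair v ` {w. w < 12 * k \<and> label_arc (label v) (label w)}"
    using assms(2) by (auto simp: out_arcs_def extremal_graph_def)
  then show ?thesis
    using card_label_Collect[OF assms(1)] by (simp add: out_degree_def card_image inj_on_def)
qed

lemma in_degree_extremal_graph:
  assumes "k > 0" and "v < 12 * k"
  shows "in_degree (extremal_graph (12 * k)) v =
    (\<Sum>i<12. if label_arc i (label v) then label_size k i else 0)"
proof -
  have "in_arcs (extremal_graph (12 * k)) v =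
      (\<lambda>w. (w, v)) ` {w. w < 12 * k \<and> label_arc (label w) (label v)}"
    using assms(2) by (auto simp: in_arcs_def extremal_graph_def)
  then show ?thesis
    using card_label_Collect[OF assms(1), of "\<lambda>i. label_arc i (label v)"]
    by (simp add: in_degree_def card_image inj_on_def)
qed

lemma sum_lessThan_12:
  "(\<Sum>i<12. f i) = f 0 + f 1 + f 2 + f 3 + f 4 + f 5 + f 6 + f 7 + f 8 + f 9 + f 10 + f (11::nat)"
  by (simp add: numeral_eq_Suc)

lemma less_12_cases:
  fixes j :: nat
  assumes "j < 12"
  shows "j \<in> {0, 1, 2, 3, 4, 5, 6, 7, 8, 9, 10, 11}"
  using assms by simp presburger

text \<open>The two deficits, class 2 with \<open>4 * k - 1\<close> vertices and label 8 with
  \<open>k - 1\<close>, never hit the same degree. Arcs into class 2 from another class start in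
  class 1, whose parts have size \<open>k\<close>; arcs out of it to another class end in class 0,
  whose parts have size at least \<open>k\<close>. Inside class 2, label 8 lowers only the outdegree
  at 11 and the indegree at 9, where the neighbouring class has at least \<open>4 * k\<close>
  vertices.\<close>

lemma label_degree_bounds:
  assumes "k > 0" and "j < 12"
  shows "5 * k - 1 \<le> (\<Sum>i<12. if label_arc j i then label_size k i else 0)"
    and "5 * k - 1 \<le> (\<Sum>i<12. if label_arc i j then label_size k i else 0)"
proof -
  \<comment> \<open>This removes the truncated subtractions before the twelve cases are
    computed.\<close>
  obtain m where "k = Suc m" using assms(1) gr0_conv_Suc by blast
  then show "5 * k - 1 \<le> (\<Sum>i<12. if label_arc j i then label_size k i else 0)"
    and "5 * k - 1 \<le> (\<Sum>i<12. if label_arc i j then label_size k i else 0)"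
    unfolding sum_lessThan_12 using less_12_cases[OF assms(2)]
    by (elim insertE emptyE; simp add: label_arc_def label_size_def)+
qed

lemma min_semidegree_extremal_graph:
  assumes "k > 0"
  shows "min_semidegree (extremal_graph (12 * k)) = 5 * k - 1"
proof -
  let ?G = "extremal_graph (12 * k)"
  have V: "verts ?G = {..<12 * k}" by (simp add: extremal_graph_def)
  \<comment> \<open>Vertex 4 lies in class 1: it sends arcs to the \<open>4 * k - 1\<close> vertices
    of class 2 and the \<open>k\<close> vertices of label 5.\<close>
  have "out_degree ?G 4 = 5 * k - 1"
    using assms
    by (simp add: out_degree_extremal_graph)
       (simp add: label_def label_arc_def label_size_def sum_lessThan_12)
  then have attained: "5 * k - 1 \<in> out_degree ?G ` verts ?G"
    using assms unfolding V by (intro image_eqI[of _ _ 4]) auto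
  have "min_out_degree ?G = 5 * k - 1"
    unfolding min_out_degree_def
  proof (rule Min_eqI)
    show "5 * k - 1 \<le> d" if "d \<in> out_degree ?G ` verts ?G" for d
      using that label_degree_bounds(1)[OF assms label_less] assms unfolding V
      by (auto simp del: One_nat_def simp: out_degree_extremal_graph)
  qed (use attained in \<open>simp_all add: V\<close>)
  \<comment> \<open>A lower bound suffices here, as the outdegrees already attain the value.\<close>
  moreover have "5 * k - 1 \<le> min_in_degree ?G"
    unfolding min_in_degree_def V
    using assms label_degree_bounds(2)[OF assms label_less]
    by (subst Min_ge_iff) (auto simp del: One_nat_def simp: in_degree_extremal_graph lessThan_empty_iff)
  ultimately show ?thesis by (simp add: min_semidegree_def)
qed

lemma card_label_class:
  assumes "k > 0"
  shows "card {v. v < 12 * k \<and> label v div 4 = 0} = 4 * k + 1"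
    and "card {v. v < 12 * k \<and> label v div 4 = 1} = 4 * k"
  using card_label_Collect[OF assms, of "\<lambda>i. i div 4 = 0"]
    card_label_Collect[OF assms, of "\<lambda>i. i div 4 = 1"]
  by (simp_all add: label_size_def sum_lessThan_12)

lemma inj_on_add_mod:
  "inj_on (\<lambda>i. (i + c) mod n) {..<n::nat}"
proof (rule inj_onI)
  fix i j assume "i \<in> {..<n}" "j \<in> {..<n}" and "(i + c) mod n = (j + c) mod n"
  then show "i = j"
    using cong_add_rcancel_nat[of i c j n] by (simp add: cong_def)
qed

lemma no_square_extremal_graph:
  assumes "k > 0"
  shows "\<not> contains_square_of_hamilton_cycle (extremal_graph (12 * k))"
proof
  let ?G = "extremal_graph (12 * k)"
  assume "contains_square_of_hamilton_cycle ?G"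
  then obtain vs where ne: "vs \<noteq> []" and dist: "distinct vs" and set: "set vs = verts ?G"
    and arc1: "\<And>i. i < length vs \<Longrightarrow> vs ! i \<rightarrow>\<^bsub>?G\<^esub> vs ! ((i + 1) mod length vs)"
    and arc2: "\<And>i. i < length vs \<Longrightarrow> vs ! i \<rightarrow>\<^bsub>?G\<^esub> vs ! ((i + 2) mod length vs)"
    unfolding contains_square_of_hamilton_cycle_def hamilton_cycle_def by blast
  let ?n = "length vs"
  have set: "set vs = {..<12 * k}" using set by (simp add: extremal_graph_def)
  have shift: "label (vs ! ((i + 2) mod ?n)) div 4 = (label (vs ! i) div 4 + 1) mod 3"
    if i: "i < ?n" for i
  proof (rule label_arc_transitive_triangle)
    \<comment> \<open>The middle arc of the triangle is the cycle arc at the next index, taken with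
      wrap-around.\<close>
    have "(i + 1) mod ?n < ?n" using ne by simp
    from arc1[OF this]
    show "label_arc (label (vs ! ((i + 1) mod ?n))) (label (vs ! ((i + 2) mod ?n)))"
      by (simp add: extremal_graph_arc_iff mod_simps)
  qed (use arc1[OF i] arc2[OF i] in \<open>simp_all add: extremal_graph_arc_iff label_less\<close>)
  \<comment> \<open>Classes are transported to positions on the cycle, where the shift by two is an
    injective map.\<close>
  define I where "I c = {i. i < ?n \<and> label (vs ! i) div 4 = c}" for c
  have card_I: "card (I c) = card {v. v < 12 * k \<and> label v div 4 = c}" for c
  proof (rule bij_betw_same_card)
    have "{v. v < 12 * k \<and> label v div 4 = c} = {v \<in> set vs. label v div 4 = c}"
      using set by auto
    also have "\<dots> = (!) vs ` I c"
      by (auto simp: I_def in_set_conv_nth)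
    finally show "bij_betw ((!) vs) (I c) {v. v < 12 * k \<and> label v div 4 = c}"
      using dist by (auto simp: bij_betw_def I_def intro!: inj_on_nth)
  qed
  have "card (I 0) \<le> card (I 1)"
  proof (rule card_inj_on_le)
    show "inj_on (\<lambda>i. (i + 2) mod ?n) (I 0)"
      by (rule inj_on_subset[OF inj_on_add_mod]) (auto simp: I_def)
    show "(\<lambda>i. (i + 2) mod ?n) ` I 0 \<subseteq> I 1"
      using shift ne by (auto simp: I_def)
  qed (simp add: I_def)
  then show False using card_label_class[OF assms] by (simp add: card_I)
qed

theorem proposition3:
  fixes n :: nat
  assumes "n > 0" and "12 dvd n"
  shows "\<exists>G :: (nat, nat \<times> nat) pre_digraph.
           oriented_graph G \<and> card (verts G) = n \<and>
           real (min_semidegree G) = 5 * real n / 12 - 1 \<and>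
           \<not> contains_square_of_hamilton_cycle G"
proof -
  obtain k where n: "n = 12 * k" using assms(2) by blast
  with assms(1) have "k > 0" by simp
  then have "real (5 * k - 1) = 5 * real n / 12 - 1" by (simp add: n of_nat_diff)
  moreover have "card (verts (extremal_graph n)) = n" by (simp add: extremal_graph_def)
  ultimately show ?thesis
    using oriented_extremal_graph[of n] min_semidegree_extremal_graph[OF \<open>k > 0\<close>]
      no_square_extremal_graph[OF \<open>k > 0\<close>]
    by (intro exI[of _ "extremal_graph n"]) (simp add: n)
qed

end
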